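(* Let $k$ be a field, and let $n\geq 3$ and $d\geq 4$ be integers. The set $\mathcal{C}_n^d(k)$ is an affine variety in $\mathrm{Mat}_{n\times n}(k)^2$ if and only if $k$ is finite or $\mathrm{diam}(\Gamma(\mathrm{Mat}_{n\times n}(k)))\leq d$.
   Context: $\mathrm{Mat}_{n\times n}(k)^2$ is identified with $k^{2n^2}$. A matrix is scalar if it is a constant multiple of the identity. The commuting graph $\Gamma(\mathrm{Mat}_{n\times n}(k))$ has as vertices the non-scalar $n\times n$ matrices over $k$, with an edge between distinct $A$ and $B$ if and only if $AB=BA$. Its diameter is the supremum of the graph distances between pairs of vertices ($\infty$ if the graph is disconnected). For non-scalar $A,B$, the commuting distance $d_k(A,B)$ is the graph distance between $A$ and $B$ (equal to $\infty$ if they lie in different connected components). It is extended to all matrices by $d_k(A,A)=0$ and $d_k(A,B)=d_k(B,A)=1$ whenever $A$ is scalar and $A\neq B$. Then $\mathcal{C}^{d}_n(k)=\{(A,B)\in\mathrm{Mat}_{n\times n}(k)^2\mid d_k(A,B)\leq d\}$. An affine variety in $k^N$ is the common zero set in $k^N$ of finitely many polynomials with coefficients in $k$ (it need not be irreducible). *)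

theory Defs
  imports "HOL-Analysis.Analysis" "HOL-Library.Poly_Mapping" "HOL-Library.Extended_Nat"
begin

text \<open>
  Polynomials over \<open>'k\<close> in variables indexed by \<open>'v\<close> are finitely supported maps from monomials
  to coefficients, a monomial being a finitely supported map from variables to exponents.
\<close>

type_synonym ('v, 'k) mpolynomial = "('v \<Rightarrow>\<^sub>0 nat) \<Rightarrow>\<^sub>0 'k"

definition eval_mpolynomial ::
    "('v::finite, 'k::field) mpolynomial \<Rightarrow> 'k ^ 'v \<Rightarrow> 'k" where
  "eval_mpolynomial p x =
     (\<Sum>m\<in>Poly_Mapping.keys p. Poly_Mapping.lookup p m *
        (\<Prod>i\<in>Poly_Mapping.keys m. (x $ i) ^ Poly_Mapping.lookup m i))"

definition affine_variety :: "('k::field ^ 'v::finite) set \<Rightarrow> bool" where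
  "affine_variety X \<longleftrightarrow>
     (\<exists>F :: ('v, 'k) mpolynomial set. finite F \<and> X = {x. \<forall>p\<in>F. eval_mpolynomial p x = 0})"

text \<open>
  A graph is given by its vertex set \<open>V\<close> and its (symmetric) edge relation \<open>E\<close> on \<open>V\<close>.
  A walk of length \<open>l\<close> is witnessed by membership in the \<open>l\<close>-fold composition of \<open>E\<close>;
  the infimum of the empty set is \<open>\<infinity>\<close> in \<open>enat\<close>.
\<close>

definition graph_dist :: "('a \<times> 'a) set \<Rightarrow> 'a \<Rightarrow> 'a \<Rightarrow> enat" where
  "graph_dist E x y = (INF l\<in>{l. (x, y) \<in> E ^^ l}. enat l)"

definition graph_diam :: "'a set \<Rightarrow> ('a \<times> 'a) set \<Rightarrow> enat" where
  "graph_diam V E = (SUP x\<in>V. SUP y\<in>V. graph_dist E x y)"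

definition scalar_matrix :: "'k::field ^ 'n::finite ^ 'n \<Rightarrow> bool" where
  "scalar_matrix A \<longleftrightarrow> (\<exists>c. A = mat c)"

definition commuting_verts :: "('k::field ^ 'n::finite ^ 'n) set" where
  "commuting_verts = {A. \<not> scalar_matrix A}"

definition commuting_edges :: "(('k::field ^ 'n::finite ^ 'n) \<times> ('k ^ 'n ^ 'n)) set" where
  "commuting_edges =
     {(A, B). A \<in> commuting_verts \<and> B \<in> commuting_verts \<and> A \<noteq> B \<and> A ** B = B ** A}"

definition commuting_dist :: "'k::field ^ 'n::finite ^ 'n \<Rightarrow> 'k ^ 'n ^ 'n \<Rightarrow> enat" where
  "commuting_dist A B =
     (if A = B then 0
      else if scalar_matrix A \<or> scalar_matrix B then 1
      else graph_dist commuting_edges A B)"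

definition commuting_pairs :: "nat \<Rightarrow> (('k::field ^ 'n::finite ^ 'n) \<times> ('k ^ 'n ^ 'n)) set" where
  "commuting_pairs d = {(A, B). commuting_dist A B \<le> enat d}"

text \<open>
  The identification of pairs of \<open>n \<times> n\<close> matrices with points of affine space of dimension
  \<open>2 n\<^sup>2\<close>, with the matrix positions of the two components as coordinate indices.
\<close>

definition matrix_pair_coords ::
    "('k ^ 'n::finite ^ 'n) \<times> ('k ^ 'n ^ 'n) \<Rightarrow> 'k ^ (('n \<times> 'n) + ('n \<times> 'n))" where
  "matrix_pair_coords P =
     (\<chi> s. case s of Inl (i, j) \<Rightarrow> fst P $ i $ j | Inr (i, j) \<Rightarrow> snd P $ i $ j)"

lemma bij_matrix_pair_coords: "bij matrix_pair_coords"
proof (rule o_bij)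
  let ?g = "\<lambda>x. ((\<chi> i j. x $ Inl (i, j)), (\<chi> i j. x $ Inr (i, j)))"
  show "?g \<circ> matrix_pair_coords = id"
    by (auto simp: fun_eq_iff matrix_pair_coords_def vec_eq_iff)
  show "matrix_pair_coords \<circ> ?g = id"
    by (auto simp: fun_eq_iff matrix_pair_coords_def vec_eq_iff split: sum.splits)
qed

end

theory Submission
  imports Defs "HOL-Computational_Algebra.Polynomial"
begin

text \<open>
  A matrix with an eigenvalue in \<open>k\<close> commutes with a rank-one matrix \<open>v w\<^sup>T\<close> built from a right and
  a left eigenvector, and for \<open>n \<ge> 3\<close> any two rank-one matrices commute with a common third one.
  So two matrices having eigenvalues in \<open>k\<close> are at distance at most 4.

  Over an infinite field every matrix \<open>A\<close> lies on a line \<open>A + t E\<close> containing infinitely many matrices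
  with an eigenvalue in \<open>k\<close>: taking \<open>E\<close> to be a diagonal matrix unit, \<open>det (1 - \<mu> (A + t E))\<close> is
  affine in \<open>t\<close>, so each nonzero \<open>\<mu>\<close> outside a finite set determines a suitable \<open>t\<close>. Hence
  a variety containing all pairs at distance at most 4 contains all pairs.
\<close>

section \<open>Evaluation of multivariate polynomials\<close>

text \<open>The product runs over all variables, not only over the support: exponent 0 contributes a
  factor 1, and multiplicativity in \<open>m\<close> then needs no bookkeeping of supports.\<close>

definition eval_monomial :: "('v::finite \<Rightarrow>\<^sub>0 nat) \<Rightarrow> 'k::field ^ 'v \<Rightarrow> 'k" where
  "eval_monomial m x = (\<Prod>i\<in>UNIV. (x $ i) ^ Poly_Mapping.lookup m i)"

lemma eval_monomial_add: "eval_monomial (m + m') x = eval_monomial m x * eval_monomial m' x"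
  by (simp add: eval_monomial_def lookup_add power_add prod.distrib)

lemma eval_monomial_0 [simp]: "eval_monomial 0 x = 1"
  by (simp add: eval_monomial_def)

lemma eval_monomial_single [simp]: "eval_monomial (Poly_Mapping.single i 1) x = x $ i"
proof -
  have "eval_monomial (Poly_Mapping.single i 1) x = (\<Prod>j\<in>UNIV. if j = i then x $ j else 1)"
    unfolding eval_monomial_def by (intro prod.cong) (auto simp: lookup_single when_def)
  then show ?thesis
    by simp
qed

text \<open>Monomials outside the support have coefficient 0. Enlarging the index set allows
  \<open>p\<close>, \<open>q\<close> and \<open>p + q\<close> to be summed over one common
  set.\<close>

lemma eval_mpolynomial_eq_sum:
  assumes "finite S" "Poly_Mapping.keys p \<subseteq> S"
  shows "eval_mpolynomial p x = (\<Sum>m\<in>S. Poly_Mapping.lookup p m * eval_monomial m x)"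
proof -
  have "(\<Prod>i\<in>Poly_Mapping.keys m. (x $ i) ^ Poly_Mapping.lookup m i) = eval_monomial m x" for m
    unfolding eval_monomial_def by (intro prod.mono_neutral_left) (auto simp: in_keys_iff)
  then have "eval_mpolynomial p x =
      (\<Sum>m\<in>Poly_Mapping.keys p. Poly_Mapping.lookup p m * eval_monomial m x)"
    by (simp add: eval_mpolynomial_def)
  also have "\<dots> = (\<Sum>m\<in>S. Poly_Mapping.lookup p m * eval_monomial m x)"
    using assms by (intro sum.mono_neutral_left) (auto simp: in_keys_iff)
  finally show ?thesis .
qed

lemma eval_mpolynomial_single [simp]:
  "eval_mpolynomial (Poly_Mapping.single m c) x = c * eval_monomial m x"
  by (subst eval_mpolynomial_eq_sum[where S = "{m}"]) auto

lemma eval_mpolynomial_add: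
  "eval_mpolynomial (p + q) x = eval_mpolynomial p x + eval_mpolynomial q x"
proof -
  let ?S = "Poly_Mapping.keys p \<union> Poly_Mapping.keys q"
  have "Poly_Mapping.keys (p + q) \<subseteq> ?S"
    by (rule keys_add)
  then show ?thesis
    by (simp add: eval_mpolynomial_eq_sum[where S = ?S] lookup_add distrib_right sum.distrib)
qed

lemma eval_mpolynomial_0 [simp]: "eval_mpolynomial 0 x = 0"
  by (simp add: eval_mpolynomial_def)

lemma eval_mpolynomial_sum:
  "eval_mpolynomial (sum f I) x = (\<Sum>i\<in>I. eval_mpolynomial (f i) x)"
  by (induction I rule: infinite_finite_induct) (auto simp: eval_mpolynomial_add)

lemma poly_mapping_eq_sum_single:
  "p = (\<Sum>m\<in>Poly_Mapping.keys p. Poly_Mapping.single m (Poly_Mapping.lookup p m))"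
  by (rule poly_mapping_eqI) (simp add: lookup_sum lookup_single when_def in_keys_iff)

lemma eval_mpolynomial_mult:
  "eval_mpolynomial (p * q) x = eval_mpolynomial p x * eval_mpolynomial q x"
proof -
  let ?P = "Poly_Mapping.keys p" and ?Q = "Poly_Mapping.keys q"
  let ?p = "Poly_Mapping.lookup p" and ?q = "Poly_Mapping.lookup q"
  have "p * q = (\<Sum>m\<in>?P. Poly_Mapping.single m (?p m)) * (\<Sum>m'\<in>?Q. Poly_Mapping.single m' (?q m'))"
    by (simp only: poly_mapping_eq_sum_single[symmetric])
  also have "\<dots> = (\<Sum>m\<in>?P. \<Sum>m'\<in>?Q. Poly_Mapping.single (m + m') (?p m * ?q m'))"
    by (simp add: sum_product mult_single)
  finally have "eval_mpolynomial (p * q) x =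
      (\<Sum>m\<in>?P. \<Sum>m'\<in>?Q. (?p m * eval_monomial m x) * (?q m' * eval_monomial m' x))"
    by (simp add: eval_mpolynomial_sum eval_monomial_add mult_ac)
  also have "\<dots> = eval_mpolynomial p x * eval_mpolynomial q x"
    by (simp add: eval_mpolynomial_eq_sum[where S = ?P] eval_mpolynomial_eq_sum[where S = ?Q]
        sum_product)
  finally show ?thesis .
qed

lemma eval_mpolynomial_prod:
  assumes "finite I"
  shows "eval_mpolynomial (prod f I) x = (\<Prod>i\<in>I. eval_mpolynomial (f i) x)"
  using assms
proof (induction I rule: finite_induct)
  case empty
  have "eval_mpolynomial (Poly_Mapping.single 0 1) x = 1"
    by (simp del: single_one)
  then show ?case
    by simp
qed (simp add: eval_mpolynomial_mult)

text \<open>There is one equation for each choice \<open>c\<close> of a coordinate for every point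
  of \<open>X\<close>: the product over \<open>a\<close> in \<open>X\<close> of
  \<open>x $ c a - a $ c a\<close>. It vanishes on \<open>X\<close>; for \<open>x\<close> outside
  \<open>X\<close>, choosing coordinates where \<open>x\<close> differs from each \<open>a\<close>
  makes it nonzero.\<close>

lemma affine_variety_finite:
  fixes X :: "('k::field ^ 'v::finite) set"
  assumes "finite X"
  shows "affine_variety X"
proof -
  define L :: "'v \<Rightarrow> 'k \<Rightarrow> ('v, 'k) mpolynomial"
    where "L i a = Poly_Mapping.single (Poly_Mapping.single i 1) 1 + Poly_Mapping.single 0 (- a)" for i a
  have L: "eval_mpolynomial (L i a) x = x $ i - a" for i a x
    unfolding L_def by (simp add: eval_mpolynomial_add del: One_nat_def)
  define P where "P c = (\<Prod>a\<in>X. L (c a) (a $ c a))" for c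
  have P: "eval_mpolynomial (P c) x = 0 \<longleftrightarrow> (\<exists>a\<in>X. x $ c a = a $ c a)" for c x
    using assms by (simp add: P_def eval_mpolynomial_prod L)
  \<comment> \<open>Choices are restricted to \<open>X\<close>, since there may be infinitely many
    functions on the whole space and the set of equations has to be finite.\<close>
  define C where "C = (PiE X (\<lambda>_. UNIV) :: ('k ^ 'v \<Rightarrow> 'v) set)"
  have "X = {x. \<forall>p\<in>P ` C. eval_mpolynomial p x = 0}"
  proof (intro equalityI subsetI)
    fix x assume "x \<in> X"
    then show "x \<in> {x. \<forall>p\<in>P ` C. eval_mpolynomial p x = 0}"
      by (auto simp: P)
  next
    fix x assume x: "x \<in> {x. \<forall>p\<in>P ` C. eval_mpolynomial p x = 0}"
    show "x \<in> X"
    proof (rule ccontr)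
      assume "x \<notin> X"
      then have "\<forall>a\<in>X. \<exists>i. x $ i \<noteq> a $ i"
        by (metis vec_eq_iff)
      then obtain c where c: "\<forall>a\<in>X. x $ c a \<noteq> a $ c a"
        by metis
      have "restrict c X \<in> C"
        by (simp add: C_def)
      then have "\<exists>a\<in>X. x $ restrict c X a = a $ restrict c X a"
        using x P by blast
      with c show False
        by auto
    qed
  qed
  moreover have "finite (P ` C)"
    using assms unfolding C_def by (intro finite_imageI finite_PiE) auto
  ultimately show ?thesis
    unfolding affine_variety_def by blast
qed

section \<open>Polynomial functions of one variable\<close>

text \<open>Speaking of functions instead of polynomials lets determinants and evaluations along a
  line be handled by closure rules, with no explicit polynomial constructed.\<close>

definition is_poly_fun :: "('k::comm_ring_1 \<Rightarrow> 'k) \<Rightarrow> bool" where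
  "is_poly_fun f \<longleftrightarrow> (\<exists>p. f = poly p)"

lemma is_poly_fun_const: "is_poly_fun (\<lambda>_. c)"
  unfolding is_poly_fun_def by (rule exI[of _ "[:c:]"]) auto

lemma is_poly_fun_ident: "is_poly_fun (\<lambda>t. t)"
  unfolding is_poly_fun_def by (rule exI[of _ "[:0, 1:]"]) auto

lemma is_poly_fun_add: "is_poly_fun f \<Longrightarrow> is_poly_fun g \<Longrightarrow> is_poly_fun (\<lambda>t. f t + g t)"
  unfolding is_poly_fun_def by (auto simp: fun_eq_iff) (metis poly_add)

lemma is_poly_fun_diff: "is_poly_fun f \<Longrightarrow> is_poly_fun g \<Longrightarrow> is_poly_fun (\<lambda>t. f t - g t)"
  unfolding is_poly_fun_def by (auto simp: fun_eq_iff) (metis poly_diff)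

lemma is_poly_fun_mult: "is_poly_fun f \<Longrightarrow> is_poly_fun g \<Longrightarrow> is_poly_fun (\<lambda>t. f t * g t)"
  unfolding is_poly_fun_def by (auto simp: fun_eq_iff) (metis poly_mult)

lemma is_poly_fun_power: "is_poly_fun f \<Longrightarrow> is_poly_fun (\<lambda>t. f t ^ n)"
  by (induction n) (simp_all add: is_poly_fun_const is_poly_fun_mult)

lemma is_poly_fun_sum:
  "(\<And>i. i \<in> I \<Longrightarrow> is_poly_fun (f i)) \<Longrightarrow> is_poly_fun (\<lambda>t. \<Sum>i\<in>I. f i t)"
  by (induction I rule: infinite_finite_induct) (simp_all add: is_poly_fun_const is_poly_fun_add)

lemma is_poly_fun_prod:
  "(\<And>i. i \<in> I \<Longrightarrow> is_poly_fun (f i)) \<Longrightarrow> is_poly_fun (\<lambda>t. \<Prod>i\<in>I. f i t)"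
  by (induction I rule: infinite_finite_induct) (simp_all add: is_poly_fun_const is_poly_fun_mult)

lemma is_poly_fun_det:
  assumes "\<And>i j. is_poly_fun (\<lambda>t. M t $ i $ j)"
  shows "is_poly_fun (\<lambda>t. det (M t))"
  unfolding det_def using assms
  by (intro is_poly_fun_sum is_poly_fun_mult is_poly_fun_prod is_poly_fun_const)

lemma is_poly_fun_eval_mpolynomial:
  assumes "\<And>i. is_poly_fun (\<lambda>t. X t $ i)"
  shows "is_poly_fun (\<lambda>t. eval_mpolynomial p (X t))"
  unfolding eval_mpolynomial_def
  using assms
  by (intro is_poly_fun_sum is_poly_fun_mult is_poly_fun_prod is_poly_fun_power is_poly_fun_const)

lemma is_poly_fun_matrix_pair_coords:
  assumes "\<And>i j. is_poly_fun (\<lambda>t. A t $ i $ j)" "\<And>i j. is_poly_fun (\<lambda>t. B t $ i $ j)"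
  shows "is_poly_fun (\<lambda>t. matrix_pair_coords (A t, B t) $ s)"
  using assms by (cases s) (auto simp: matrix_pair_coords_def)

lemma is_poly_fun_eq_0:
  fixes f :: "'k::idom \<Rightarrow> 'k"
  assumes "is_poly_fun f" "infinite {t. f t = 0}"
  shows "f t = 0"
proof -
  obtain p where p: "f = poly p"
    using assms(1) unfolding is_poly_fun_def by blast
  with assms(2) have "p = 0"
    using poly_roots_finite by blast
  with p show ?thesis
    by simp
qed

section \<open>Density of the matrices with an eigenvalue\<close>

definition has_eigenvalue :: "'k::field ^ 'n::finite ^ 'n \<Rightarrow> bool" where
  "has_eigenvalue A \<longleftrightarrow> (\<exists>c. det (A - mat c) = 0)"

definition diag_unit :: "'n \<Rightarrow> 'k::field \<Rightarrow> 'k ^ 'n::finite ^ 'n" where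
  "diag_unit i t = (\<chi> r c. if r = i \<and> c = i then t else 0)"

text \<open>This rests on A - (1/\<mu>) I = (-1/\<mu>) (I - \<mu> A). The reciprocal form of the
  characteristic polynomial is chosen because its value at \<mu> = 0 is 1, whatever \<open>A\<close>
  is.\<close>

lemma has_eigenvalueI_reciprocal:
  fixes A :: "'k::field ^ 'n::finite ^ 'n"
  assumes "\<mu> \<noteq> 0" "det (mat 1 - (\<chi> r. \<mu> *s A $ r)) = 0"
  shows "has_eigenvalue A"
proof -
  have "A - mat (1 / \<mu>) = (\<chi> r. (- 1 / \<mu>) *s (mat 1 - (\<chi> r. \<mu> *s A $ r)) $ r)"
    using assms(1) by (auto simp: vec_eq_iff mat_def field_simps)
  then have "det (A - mat (1 / \<mu>)) = 0"
    using assms(2) by (simp only: det_rows_mul vec_lambda_eta) simp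
  then show ?thesis
    unfolding has_eigenvalue_def by blast
qed

lemma infinite_has_eigenvalue_line:
  fixes A :: "'k::field ^ 'n::finite ^ 'n"
  assumes inf: "infinite (UNIV :: 'k set)"
  shows "infinite {t. has_eigenvalue (A + diag_unit i t)}" (is "infinite ?T")
proof
  assume fin: "finite ?T"
  let ?N = "\<lambda>\<mu>. mat 1 - (\<chi> r. \<mu> *s A $ r) :: 'k ^ 'n ^ 'n"
  define F where "F \<mu> = det (?N \<mu>)" for \<mu>
  define G where "G \<mu> = det (\<chi> r. if r = i then axis i 1 else ?N \<mu> $ r)" for \<mu>
  \<comment> \<open>Only row \<open>i\<close> depends on \<open>t\<close>: it is row
    \<open>i\<close> of \<open>?N \<mu>\<close> plus -\<mu> t times a unit vector. Linearity of the
    determinant in that row makes it affine in \<open>t\<close>.\<close>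
  have line: "det (mat 1 - (\<chi> r. \<mu> *s (A + diag_unit i t) $ r)) = F \<mu> - \<mu> * t * G \<mu>" for \<mu> t
  proof -
    have "mat 1 - (\<chi> r. \<mu> *s (A + diag_unit i t) $ r) =
        (\<chi> r. if r = i then ?N \<mu> $ r + (- \<mu> * t) *s axis i 1 else ?N \<mu> $ r)"
      by (auto simp: vec_eq_iff diag_unit_def axis_def algebra_simps)
    then have "det (mat 1 - (\<chi> r. \<mu> *s (A + diag_unit i t) $ r)) =
        det (\<chi> r. if r = i then ?N \<mu> $ r else ?N \<mu> $ r) + (- \<mu> * t) * G \<mu>"
      by (simp only: det_row_add det_row_mul G_def)
    also have "(\<chi> r. if r = i then ?N \<mu> $ r else ?N \<mu> $ r) = ?N \<mu>"
      by (simp add: vec_eq_iff)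
    finally show ?thesis
      by (simp add: F_def)
  qed
  have N: "is_poly_fun (\<lambda>\<mu>. ?N \<mu> $ r $ c)" for r c
    unfolding vector_minus_component vec_lambda_beta vector_smult_component
    by (intro is_poly_fun_diff is_poly_fun_mult is_poly_fun_const is_poly_fun_ident)
  have F: "is_poly_fun F"
    unfolding F_def by (intro is_poly_fun_det N)
  have G: "is_poly_fun G"
    unfolding G_def
  proof (intro is_poly_fun_det)
    fix r c
    show "is_poly_fun (\<lambda>\<mu>. (\<chi> r. if r = i then axis i 1 else ?N \<mu> $ r) $ r $ c)"
      using N[of r c] by (cases "r = i") (simp_all add: is_poly_fun_const)
  qed
  have F0: "F 0 = 1" and G0: "G 0 = 1"
  proof -
    have *: "?N 0 = mat 1"
      by (simp add: vec_eq_iff)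
    then show "F 0 = 1"
      by (simp add: F_def)
    have "(\<chi> r. if r = i then axis i 1 else ?N 0 $ r) = mat 1"
      unfolding * by (auto simp: vec_eq_iff axis_def mat_def)
    then show "G 0 = 1"
      by (simp add: G_def)
  qed
  \<comment> \<open>If \<open>?T\<close> is finite, \<open>H\<close> is a polynomial function of
    \<mu>. It is shown to vanish for every nonzero \<mu>, although \<open>H 0 = 1\<close>.\<close>
  define H where "H \<mu> = G \<mu> * (\<Prod>t\<in>?T. F \<mu> - \<mu> * t * G \<mu>)" for \<mu>
  have "H \<mu> = 0" if "\<mu> \<noteq> 0" for \<mu>
  proof (cases "G \<mu> = 0")
    case False
    \<comment> \<open>This is the root of the affine function of \<open>t\<close>, so
      \<open>t\<close> lies in \<open>?T\<close> and contributes a zero factor to the product in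
      \<open>H\<close>.\<close>
    define t where "t = F \<mu> / (\<mu> * G \<mu>)"
    have t: "F \<mu> - \<mu> * t * G \<mu> = 0"
      using that False by (simp add: t_def)
    then have "t \<in> ?T"
      using has_eigenvalueI_reciprocal[OF that, of "A + diag_unit i t"] line[of \<mu> t]
      by (simp only: mem_Collect_eq)
    with t fin show ?thesis
      unfolding H_def by (metis (no_types, lifting) mult_zero_right prod_zero)
  qed (simp add: H_def)
  then have "- {0} \<subseteq> {\<mu>. H \<mu> = 0}"
    by auto
  moreover have "infinite (- {0 :: 'k})"
    using inf by (simp add: Compl_eq_Diff_UNIV)
  ultimately have "infinite {\<mu>. H \<mu> = 0}"
    using finite_subset by blast
  moreover have "is_poly_fun H"
    unfolding H_def
    by (intro is_poly_fun_mult is_poly_fun_prod is_poly_fun_diff is_poly_fun_const is_poly_fun_ident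
        F G)
  ultimately have "H 0 = 0"
    using is_poly_fun_eq_0 by blast
  then show False
    by (simp add: H_def F0 G0)
qed

text \<open>A defining polynomial restricted to a line has infinitely many roots, hence vanishes at
  \<open>t = 0\<close> as well. The two components are freed one after the other: first
  \<open>A\<close> with \<open>B\<close> still having an eigenvalue, then \<open>B\<close> with
  \<open>A\<close> arbitrary.\<close>

lemma affine_variety_eq_UNIV:
  fixes S :: "(('k::field ^ 'n::finite ^ 'n) \<times> ('k ^ 'n ^ 'n)) set"
  assumes inf: "infinite (UNIV :: 'k set)"
    and var: "affine_variety (matrix_pair_coords ` S)"
    and S: "\<And>A B. has_eigenvalue A \<Longrightarrow> has_eigenvalue B \<Longrightarrow> (A, B) \<in> S"
  shows "S = UNIV"
proof -
  obtain P where P: "matrix_pair_coords ` S = {x. \<forall>p\<in>P. eval_mpolynomial p x = 0}"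
    using var unfolding affine_variety_def by blast
  have mem: "Z \<in> S \<longleftrightarrow> (\<forall>p\<in>P. eval_mpolynomial p (matrix_pair_coords Z) = 0)" for Z
    using P inj_image_mem_iff[OF bij_is_inj[OF bij_matrix_pair_coords], of Z S] by auto
  define i :: 'n where "i = undefined"
  have coord: "is_poly_fun (\<lambda>t. (A + diag_unit i t) $ r $ c)" for A :: "'k ^ 'n ^ 'n" and r c
    by (cases "r = i \<and> c = i")
      (auto simp: diag_unit_def intro: is_poly_fun_add is_poly_fun_const is_poly_fun_ident)
  have line0: "A + diag_unit i 0 = A" for A :: "'k ^ 'n ^ 'n"
    by (simp add: vec_eq_iff diag_unit_def)
  have left: "(A, B) \<in> S" if "has_eigenvalue B" for A B
    unfolding mem
  proof
    fix p assume p: "p \<in> P"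
    let ?f = "\<lambda>t. eval_mpolynomial p (matrix_pair_coords (A + diag_unit i t, B))"
    have "?f 0 = 0"
    proof (rule is_poly_fun_eq_0[where f = ?f])
      show "is_poly_fun ?f"
        by (intro is_poly_fun_eval_mpolynomial is_poly_fun_matrix_pair_coords coord is_poly_fun_const)
      have "{t. has_eigenvalue (A + diag_unit i t)} \<subseteq> {t. ?f t = 0}"
        using S that mem p by blast
      then show "infinite {t. ?f t = 0}"
        using infinite_has_eigenvalue_line[OF inf] finite_subset by blast
    qed
    then show "eval_mpolynomial p (matrix_pair_coords (A, B)) = 0"
      by (simp add: line0)
  qed
  have "(A, B) \<in> S" for A B
    unfolding mem
  proof
    fix p assume p: "p \<in> P"
    let ?f = "\<lambda>t. eval_mpolynomial p (matrix_pair_coords (A, B + diag_unit i t))"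
    have "?f 0 = 0"
    proof (rule is_poly_fun_eq_0[where f = ?f])
      show "is_poly_fun ?f"
        by (intro is_poly_fun_eval_mpolynomial is_poly_fun_matrix_pair_coords coord is_poly_fun_const)
      have "{t. has_eigenvalue (B + diag_unit i t)} \<subseteq> {t. ?f t = 0}"
        using left mem p by blast
      then show "infinite {t. ?f t = 0}"
        using infinite_has_eigenvalue_line[OF inf] finite_subset by blast
    qed
    then show "eval_mpolynomial p (matrix_pair_coords (A, B)) = 0"
      by (simp add: line0)
  qed
  then show ?thesis
    by auto
qed

section \<open>Distances between matrices with an eigenvalue\<close>

definition outer_product :: "'k::field ^ 'n::finite \<Rightarrow> 'k ^ 'n \<Rightarrow> 'k ^ 'n ^ 'n" where
  "outer_product v w = (\<chi> i j. v $ i * w $ j)"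

lemma matrix_mult_outer_product: "A ** outer_product v w = outer_product (A *v v) w"
  by (simp add: outer_product_def matrix_matrix_mult_def matrix_vector_mult_def vec_eq_iff
      sum_distrib_right mult.assoc)

lemma outer_product_matrix_mult: "outer_product v w ** A = outer_product v (w v* A)"
  by (simp add: outer_product_def matrix_matrix_mult_def vector_matrix_mult_def vec_eq_iff
      sum_distrib_left mult_ac)

lemma outer_product_scale: "outer_product (c *s v) w = outer_product v (c *s w)"
  by (simp add: outer_product_def vec_eq_iff mult_ac)

text \<open>The product of v w^T and v' w'^T is the scalar w^T v' times v w'^T.\<close>

lemma outer_product_mult_eq_0:
  assumes "(\<Sum>i\<in>UNIV. w $ i * v' $ i) = 0"
  shows "outer_product v w ** outer_product v' w' = 0"
proof -
  have "(\<Sum>k\<in>UNIV. v $ i * w $ k * (v' $ k * w' $ j)) =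
      v $ i * (\<Sum>k\<in>UNIV. w $ k * v' $ k) * w' $ j" for i j
    by (simp add: sum_distrib_left sum_distrib_right mult_ac)
  then show ?thesis
    using assms by (simp add: outer_product_def matrix_matrix_mult_def vec_eq_iff)
qed

text \<open>A nonzero matrix of rank one cannot be a multiple of the identity in dimension at least
  2. In entries: a nonzero entry must be diagonal, and the zeros beside it in row \<open>i\<close>
  force another diagonal entry to vanish.\<close>

lemma not_scalar_outer_product:
  fixes v w :: "'k::field ^ 'n::finite"
  assumes "CARD('n) \<ge> 2" "v \<noteq> 0" "w \<noteq> 0"
  shows "\<not> scalar_matrix (outer_product v w)"
proof
  assume "scalar_matrix (outer_product v w)"
  then obtain c where c: "outer_product v w = mat c"
    unfolding scalar_matrix_def by blast
  have ent: "v $ i * w $ j = (if i = j then c else 0)" for i j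
    using arg_cong[OF c, of "\<lambda>M. M $ i $ j"] by (simp add: outer_product_def mat_def)
  obtain i j where ij: "v $ i \<noteq> 0" "w $ j \<noteq> 0"
    using assms(2,3) by (auto simp: vec_eq_iff)
  then have "i = j" "c \<noteq> 0"
    using ent[of i j] by (auto split: if_splits)
  obtain l where "l \<noteq> i"
    using assms(1)
    by (metis (full_types) UNIV_I card_2_iff' card_le_Suc0_iff_eq finite_class.finite_UNIV
        not_less_eq_eq numeral_2_eq_2)
  then have "w $ l = 0" "v $ l * w $ l = c"
    using ent[of i l] ent[of l l] ij by auto
  with \<open>c \<noteq> 0\<close> show False
    by simp
qed

lemma det_eq_0_imp_ker:
  fixes A :: "'k::field ^ 'n::finite ^ 'n"
  assumes "det A = 0"
  obtains v where "v \<noteq> 0" "A *v v = 0"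
  using assms invertible_det_nz[of A] invertible_left_inverse[of A] matrix_left_invertible_ker[of A]
  by blast

text \<open>Two linear equations in at least three unknowns have a nonzero solution: placing
  \<open>u\<close> and \<open>w\<close> as rows of a square matrix leaves a zero row, so the matrix
  is singular.\<close>

lemma obtain_orthogonal:
  fixes u w :: "'k::field ^ 'n::finite"
  assumes "CARD('n) \<ge> 3"
  obtains z where "z \<noteq> 0" "(\<Sum>i\<in>UNIV. u $ i * z $ i) = 0" "(\<Sum>i\<in>UNIV. w $ i * z $ i) = 0"
proof -
  obtain T :: "'n set" where "card T = 3"
    using assms by (metis obtain_subset_with_card_n)
  then obtain a b c :: 'n where abc: "a \<noteq> b" "a \<noteq> c" "b \<noteq> c"
    by (metis card_3_iff)
  define M :: "'k ^ 'n ^ 'n" where "M = (\<chi> r. if r = a then u else if r = b then w else 0)"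
  have "det M = 0"
    by (rule det_zero_row(2)[of c]) (use abc in \<open>auto simp: M_def row_def vec_eq_iff\<close>)
  then obtain z where z: "z \<noteq> 0" "M *v z = 0"
    by (rule det_eq_0_imp_ker)
  have "(M *v z) $ a = (\<Sum>i\<in>UNIV. u $ i * z $ i)" "(M *v z) $ b = (\<Sum>i\<in>UNIV. w $ i * z $ i)"
    using abc by (auto simp: M_def matrix_vector_mult_def)
  with z that show ?thesis
    by simp
qed

text \<open>A right eigenvector \<open>v\<close> and a left eigenvector \<open>w\<close> are taken
  for the same eigenvalue \<open>c\<close>; both products then equal c v w^T. The left one exists
  because transposing preserves the determinant.\<close>

lemma has_eigenvalue_commutes_outer_product:
  fixes A :: "'k::field ^ 'n::finite ^ 'n"
  assumes "has_eigenvalue A"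
  obtains v w where "v \<noteq> 0" "w \<noteq> 0" "A ** outer_product v w = outer_product v w ** A"
proof -
  obtain c where c: "det (A - mat c) = 0"
    using assms unfolding has_eigenvalue_def by blast
  then obtain v where v: "v \<noteq> 0" "(A - mat c) *v v = 0"
    by (rule det_eq_0_imp_ker)
  from c have "det (transpose (A - mat c)) = 0"
    by simp
  then obtain w where w: "w \<noteq> 0" "transpose (A - mat c) *v w = 0"
    by (rule det_eq_0_imp_ker)
  have "A *v v = c *s v"
    using v(2) by (simp add: vec_eq_iff matrix_vector_mult_def mat_def left_diff_distrib
        sum_subtractf if_distrib[where f = "\<lambda>x. x * _"] cong: if_cong)
  moreover have "w v* A = c *s w"
    using w(2) by (simp add: vec_eq_iff vector_matrix_mult_def mat_def algebra_simps
        sum_subtractf if_distrib[where f = "\<lambda>x. _ * x"] cong: if_cong)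
  ultimately have "A ** outer_product v w = outer_product v w ** A"
    by (simp add: matrix_mult_outer_product outer_product_matrix_mult outer_product_scale)
  with v w that show ?thesis
    by blast
qed

lemma graph_dist_le: "(x, y) \<in> E ^^ l \<Longrightarrow> graph_dist E x y \<le> enat l"
  unfolding graph_dist_def by (rule INF_lower) simp

lemma graph_dist_refl [simp]: "graph_dist E x x = 0"
  using graph_dist_le[of x x 0 E] by (simp add: zero_enat_def[symmetric])

text \<open>Lengths are bounded rather than exact because edges join distinct matrices: when
  \<open>B = C\<close> the walk is not extended. Chains can thus be built without checking that
  neighbours differ.\<close>

lemma relpow_commuting_step:
  assumes "\<exists>l\<le>n. (A, B) \<in> commuting_edges ^^ l"
    and "\<not> scalar_matrix B" "\<not> scalar_matrix C" "B ** C = C ** B"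
  shows "\<exists>l\<le>Suc n. (A, C) \<in> commuting_edges ^^ l"
proof (cases "B = C")
  case True
  with assms(1) show ?thesis
    using le_SucI by blast
next
  case False
  then have "(B, C) \<in> commuting_edges"
    using assms(2-4) by (simp add: commuting_edges_def commuting_verts_def)
  with assms(1) show ?thesis
    by (meson Suc_le_mono relpow_Suc_I)
qed

lemma commuting_dist_le_4:
  fixes A B :: "'k::field ^ 'n::finite ^ 'n"
  assumes card: "CARD('n) \<ge> 3" and "has_eigenvalue A" "has_eigenvalue B"
  shows "commuting_dist A B \<le> enat 4"
proof (cases "A = B \<or> scalar_matrix A \<or> scalar_matrix B")
  case True
  then show ?thesis
    by (auto simp: commuting_dist_def one_enat_def)
next
  case False
  obtain v w where vw: "v \<noteq> 0" "w \<noteq> 0" "A ** outer_product v w = outer_product v w ** A"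
    using has_eigenvalue_commutes_outer_product[OF assms(2)] by blast
  obtain v' w' where vw': "v' \<noteq> 0" "w' \<noteq> 0" "B ** outer_product v' w' = outer_product v' w' ** B"
    using has_eigenvalue_commutes_outer_product[OF assms(3)] by blast
  \<comment> \<open>The middle vertex x y^T annihilates v w^T and v' w'^T from both sides:
    \<open>x\<close> is orthogonal to \<open>w\<close> and \<open>w'\<close>, and \<open>y\<close>
    to \<open>v\<close> and \<open>v'\<close>. The walk is A, v w^T, x y^T, v' w'^T, B.\<close>
  obtain x where x: "x \<noteq> 0" "(\<Sum>i\<in>UNIV. w $ i * x $ i) = 0" "(\<Sum>i\<in>UNIV. w' $ i * x $ i) = 0"
    using obtain_orthogonal[OF card] by blast
  obtain y where y: "y \<noteq> 0" "(\<Sum>i\<in>UNIV. v $ i * y $ i) = 0" "(\<Sum>i\<in>UNIV. v' $ i * y $ i) = 0"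
    using obtain_orthogonal[OF card] by blast
  have ns: "\<not> scalar_matrix (outer_product v w)" "\<not> scalar_matrix (outer_product v' w')"
    "\<not> scalar_matrix (outer_product x y)"
    using card vw vw' x y by (simp_all add: not_scalar_outer_product)
  have comm: "outer_product v w ** outer_product x y = outer_product x y ** outer_product v w"
    "outer_product x y ** outer_product v' w' = outer_product v' w' ** outer_product x y"
    using x y by (simp_all add: outer_product_mult_eq_0 mult.commute)
  have "\<exists>l\<le>0. (A, A) \<in> commuting_edges ^^ l"
    by simp
  then have "\<exists>l\<le>Suc 0. (A, outer_product v w) \<in> commuting_edges ^^ l"
    by (rule relpow_commuting_step) (use False ns vw in auto)
  then have "\<exists>l\<le>Suc (Suc 0). (A, outer_product x y) \<in> commuting_edges ^^ l"
    by (rule relpow_commuting_step) (use ns comm in auto)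
  then have "\<exists>l\<le>Suc (Suc (Suc 0)). (A, outer_product v' w') \<in> commuting_edges ^^ l"
    by (rule relpow_commuting_step) (use ns comm in auto)
  then have "\<exists>l\<le>Suc (Suc (Suc (Suc 0))). (A, B) \<in> commuting_edges ^^ l"
    by (rule relpow_commuting_step) (use False ns vw' in auto)
  then obtain l where "l \<le> 4" "(A, B) \<in> commuting_edges ^^ l"
    by (auto simp: eval_nat_numeral)
  then have "graph_dist commuting_edges A B \<le> enat 4"
    using graph_dist_le[of A B l commuting_edges] by (meson enat_ord_simps(1) order_trans)
  with False show ?thesis
    by (simp add: commuting_dist_def)
qed

text \<open>Pairs with a scalar component have distance at most 1, within the bound, so only pairs
  of vertices impose a condition, and a supremum is bounded exactly when all its terms are.\<close>

lemma commuting_pairs_eq_UNIV_iff: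
  assumes "d \<ge> 1"
  shows "(commuting_pairs d :: (('k::field ^ 'n::finite ^ 'n) \<times> ('k ^ 'n ^ 'n)) set) = UNIV \<longleftrightarrow>
    graph_diam (commuting_verts :: ('k ^ 'n ^ 'n) set) commuting_edges \<le> enat d"
proof -
  have "commuting_dist A B \<le> enat d \<longleftrightarrow>
      (A \<in> commuting_verts \<longrightarrow> B \<in> commuting_verts \<longrightarrow> graph_dist commuting_edges A B \<le> enat d)"
    for A B :: "'k ^ 'n ^ 'n"
    using assms by (auto simp: commuting_dist_def commuting_verts_def one_enat_def)
  then show ?thesis
    by (simp add: graph_diam_def SUP_le_iff commuting_pairs_def set_eq_iff) blast
qed

theorem proposition1p2:
  fixes d :: nat
  assumes "CARD('n::finite) \<ge> 3" and "d \<ge> 4"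
  shows "affine_variety
           (matrix_pair_coords ` (commuting_pairs d :: (('k::field ^ 'n ^ 'n) \<times> ('k ^ 'n ^ 'n)) set))
         \<longleftrightarrow> finite (UNIV :: 'k set) \<or>
             graph_diam (commuting_verts :: ('k ^ 'n ^ 'n) set) commuting_edges \<le> enat d"
proof -
  let ?C = "commuting_pairs d :: (('k ^ 'n ^ 'n) \<times> ('k ^ 'n ^ 'n)) set"
  have diam: "?C = UNIV \<longleftrightarrow>
      graph_diam (commuting_verts :: ('k ^ 'n ^ 'n) set) commuting_edges \<le> enat d"
    using assms(2) by (intro commuting_pairs_eq_UNIV_iff) simp
  have "?C = UNIV" if "affine_variety (matrix_pair_coords ` ?C)" "infinite (UNIV :: 'k set)"
  proof (rule affine_variety_eq_UNIV[OF that(2,1)])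
    fix A B :: "'k ^ 'n ^ 'n"
    assume "has_eigenvalue A" "has_eigenvalue B"
    then have "commuting_dist A B \<le> enat 4"
      by (rule commuting_dist_le_4[OF assms(1)])
    also have "\<dots> \<le> enat d"
      using assms(2) by simp
    finally show "(A, B) \<in> ?C"
      by (simp add: commuting_pairs_def)
  qed
  moreover have "affine_variety (matrix_pair_coords ` ?C)" if "finite (UNIV :: 'k set)"
  proof (rule affine_variety_finite)
    \<comment> \<open>Over a finite field the ambient space is finite, and so is every subset of
      it.\<close>
    have "finite (UNIV :: ('n \<times> 'n + 'n \<times> 'n \<Rightarrow> 'k) set)"
      using finite_PiE[of UNIV "\<lambda>_ :: 'n \<times> 'n + 'n \<times> 'n. UNIV :: 'k set"] that
      by (simp add: PiE_UNIV_domain)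
    then have "finite (range (vec_lambda :: ('n \<times> 'n + 'n \<times> 'n \<Rightarrow> 'k) \<Rightarrow> _))"
      by simp
    then show "finite (matrix_pair_coords ` ?C)"
      by (rule rev_finite_subset) (metis UNIV_I image_subset_iff rangeI vec_lambda_eta)
  qed
  \<comment> \<open>The coordinate map is onto, so the image is the whole space, cut out by the
    empty set of equations.\<close>
  moreover have "affine_variety (matrix_pair_coords ` ?C)" if "?C = UNIV"
    using that bij_is_surj[OF bij_matrix_pair_coords] unfolding affine_variety_def
    by (intro exI[of _ "{}"]) simp
  ultimately show ?thesis
    using diam by blast
qed

end
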